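(* Let $M$ be a proper ultrametric space with a distinguished point $0$, and let $Y\subset\mathrm{Lip}_0(M)$ be the set associated with a fixed one-to-one dense sequence $S=\{s_n:n\in\mathbb{N}\}$ in $M$ with $s_1=0$. Then $\mathrm{lip}^u_0(M)=Y$.
   Context: A metric space $(M,d)$ is ultrametric if $d(x,y)\le\max\{d(x,z),d(z,y)\}$ for all $x,y,z\in M$, and proper if every closed ball is compact. $\mathrm{Lip}_0(M)$ is the Banach space of real-valued Lipschitz functions $f$ on $M$ with $f(0)=0$, normed by the best Lipschitz constant. Write $B[0,r]=\{y\in M:d(0,y)\le r\}$. A function $f\in\mathrm{Lip}_0(M)$ is uniformly locally flat if for every $\varepsilon>0$ there is $\delta>0$ such that $d(x,y)<\delta$ (with $x\neq y$) implies $|f(x)-f(y)|<\varepsilon d(x,y)$. It is flat at infinity if $\lim_{r\to\infty}\sup\{\frac{f(x)-f(y)}{d(x,y)}: x\ne y,\ x\notin B[0,r]\text{ or }y\notin B[0,r]\}=0$ (a supremum over the empty set being $0$). $\mathrm{lip}_0^u(M)$ is the set of all $f\in\mathrm{Lip}_0(M)$ that are uniformly locally flat and flat at infinity. Definition of $Y$: fix a one-to-one sequence $(s_n)_{n\in\mathbb{N}}$ with dense range $S$ in $M$ and $s_1=0$. For $n\in\mathbb{N}$, $x\in M$ let $S_n=\{s_1,\dots,s_n\}$, $i_n(x)=\min\{k\le n: d(x,S_n)=d(x,s_k)\}$, where $d(x,S_n)=\min_{k\le n}d(x,s_k)$, and $r_n\colon M\to S_n$, $r_n(x)=s_{i_n(x)}$.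 Then $Y$ is the set of all $f\in\mathrm{Lip}_0(M)$ such that for every $\varepsilon>0$ there is $N\in\mathbb{N}$ such that for all $x,y\in M$, $r_N(x)=r_N(y)$ implies $|f(x)-f(y)|\le\varepsilon d(x,y)$. *)

theory Defs
  imports "HOL-Analysis.Analysis"
begin

text \<open>
  The metric space \<open>M\<close> is a type of class \<open>metric_space\<close>; its distinguished point is
  the explicit parameter \<open>p\<close>.
\<close>

definition Lip0 :: "'a::metric_space \<Rightarrow> ('a \<Rightarrow> real) set" where
  "Lip0 p = {f. f p = 0 \<and> (\<exists>C. C-lipschitz_on UNIV f)}"

definition uniformly_locally_flat :: "('a::metric_space \<Rightarrow> real) \<Rightarrow> bool" where
  "uniformly_locally_flat f \<longleftrightarrow>
     (\<forall>\<epsilon>>0. \<exists>\<delta>>0. \<forall>x y. x \<noteq> y \<and> dist x y < \<delta> \<longrightarrow> \<bar>f x - f y\<bar> < \<epsilon> * dist x y)"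

definition outer_slopes :: "'a::metric_space \<Rightarrow> ('a \<Rightarrow> real) \<Rightarrow> real \<Rightarrow> real set" where
  "outer_slopes p f r =
     {(f x - f y) / dist x y | x y. x \<noteq> y \<and> (x \<notin> cball p r \<or> y \<notin> cball p r)}"

text \<open>
  On \<open>real\<close>, \<open>Sup\<close> is unspecified for empty and for unbounded sets. The empty
  case is set to \<open>0\<close> by hand; for Lipschitz \<open>f\<close> the slopes are bounded, so the predicate
  is only meant for members of \<open>Lip0 p\<close>.
\<close>

definition flat_at_infinity :: "'a::metric_space \<Rightarrow> ('a \<Rightarrow> real) \<Rightarrow> bool" where
  "flat_at_infinity p f \<longleftrightarrow>
     ((\<lambda>r. if outer_slopes p f r = {} then 0 else Sup (outer_slopes p f r)) \<longlongrightarrow> 0) at_top"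

definition lip0u :: "'a::metric_space \<Rightarrow> ('a \<Rightarrow> real) set" where
  "lip0u p = {f \<in> Lip0 p. uniformly_locally_flat f \<and> flat_at_infinity p f}"

text \<open>
  Sequences are indexed from \<open>1\<close>; the value \<open>s 0\<close> is never used, and
  \<open>nearest_index s n\<close> and \<open>nearest_pt s n\<close> are meaningful for \<open>n \<ge> 1\<close> only.
\<close>

definition nearest_index :: "(nat \<Rightarrow> 'a::metric_space) \<Rightarrow> nat \<Rightarrow> 'a \<Rightarrow> nat" where
  "nearest_index s n x =
     Min {k \<in> {1..n}. dist x (s k) = Min ((\<lambda>j. dist x (s j)) ` {1..n})}"

definition nearest_pt :: "(nat \<Rightarrow> 'a::metric_space) \<Rightarrow> nat \<Rightarrow> 'a \<Rightarrow> 'a" where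
  "nearest_pt s n x = s (nearest_index s n x)"

definition Y_space :: "'a::metric_space \<Rightarrow> (nat \<Rightarrow> 'a) \<Rightarrow> ('a \<Rightarrow> real) set" where
  "Y_space p s = {f \<in> Lip0 p. \<forall>\<epsilon>>0. \<exists>N\<ge>1. \<forall>x y.
     nearest_pt s N x = nearest_pt s N y \<longrightarrow> \<bar>f x - f y\<bar> \<le> \<epsilon> * dist x y}"

end

theory Submission
  imports Defs
begin

text \<open>
  Everything follows from the geometry of the fibres of the nearest-point map
  \<open>x \<mapsto> nearest_pt s N x\<close>, whose range is the finite set \<open>F = s ` {1..N}\<close>.

  If \<open>f\<close> is uniformly locally flat and flat at infinity, only slopes over pairs of points that
  are at least \<open>\<delta>\<close> apart inside some ball can be large.  The ball is compact, so for large \<open>N\<close>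
  the set \<open>F\<close> is \<open>\<delta>\<close>-dense in it (\<open>finite_segment_dense_in_compact\<close>), and two points of the ball
  with the same nearest point are then less than \<open>\<delta>\<close> apart.

  Conversely, suppose that \<open>f\<close> has small slopes on each fibre.  In an ultrametric space two points
  that are closer to each other than one of them is to \<open>F\<close> have the same distances to all of \<open>F\<close>.
  This gives two facts.  The fibres are uniformly separated: points at distance less than the
  minimal gap of \<open>F\<close> lie in one fibre (\<open>nearest_pt_locally_constant\<close>), so that \<open>f\<close> is uniformly
  locally flat.  And there is a ball around \<open>p = s 1\<close> outside which every point is equidistant from
  all of \<open>F\<close>, hence in the fibre of \<open>p\<close> (\<open>nearest_pt_far_away\<close>).  A pair with both points
  outside this ball has a small slope.  If \<open>x\<close> is outside and \<open>y\<close> inside, then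
  \<open>dist x y = dist x p\<close>, the slope between \<open>x\<close> and \<open>p\<close> is small, and \<open>f y\<close> is bounded, so it
  becomes negligible when divided by \<open>dist x p\<close>.
\<close>

section \<open>Ultrametric triangles\<close>

lemma ultrametric_isosceles:
  fixes x y z :: "'a::metric_space"
  assumes ultrametric: "\<And>x y z :: 'a. dist x y \<le> max (dist x z) (dist z y)"
    and "dist x y < dist x z"
  shows "dist y z = dist x z"
  using ultrametric[of x z y] ultrametric[of y z x] assms(2)
  by (auto simp: dist_commute max_def split: if_splits)

section \<open>The nearest-point map\<close>

lemma nearest_index_props:
  assumes "1 \<le> n"
  shows "nearest_index s n x \<in> {1..n}"
    and "dist x (s (nearest_index s n x)) = Min ((\<lambda>j. dist x (s j)) ` {1..n})"
proof -
  let ?m = "Min ((\<lambda>j. dist x (s j)) ` {1..n})"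
  have "?m \<in> (\<lambda>j. dist x (s j)) ` {1..n}"
    using assms by (intro Min_in) auto
  then have "{k \<in> {1..n}. dist x (s k) = ?m} \<noteq> {}"
    by auto
  then have "Min {k \<in> {1..n}. dist x (s k) = ?m} \<in> {k \<in> {1..n}. dist x (s k) = ?m}"
    by (intro Min_in) auto
  then show "nearest_index s n x \<in> {1..n}" "dist x (s (nearest_index s n x)) = ?m"
    unfolding nearest_index_def by auto
qed

lemma nearest_pt_in_range:
  assumes "1 \<le> n"
  shows "nearest_pt s n x \<in> s ` {1..n}"
  unfolding nearest_pt_def using nearest_index_props(1)[OF assms] by blast

lemma dist_nearest_pt_le:
  assumes "j \<in> {1..n}"
  shows "dist x (nearest_pt s n x) \<le> dist x (s j)"
proof -
  have "dist x (nearest_pt s n x) = Min ((\<lambda>j. dist x (s j)) ` {1..n})"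
    unfolding nearest_pt_def using assms by (intro nearest_index_props(2)) auto
  also have "\<dots> \<le> dist x (s j)"
    using assms by (intro Min_le) auto
  finally show ?thesis .
qed

lemma nearest_pt_cong:
  assumes "\<And>j. j \<in> {1..n} \<Longrightarrow> dist x (s j) = dist y (s j)"
  shows "nearest_pt s n x = nearest_pt s n y"
proof -
  have image_eq: "(\<lambda>j. dist x (s j)) ` {1..n} = (\<lambda>j. dist y (s j)) ` {1..n}"
    using assms by (intro image_cong) auto
  have "{k \<in> {1..n}. dist x (s k) = m} = {k \<in> {1..n}. dist y (s k) = m}" for m
    using assms by auto
  then show ?thesis
    unfolding nearest_pt_def nearest_index_def image_eq by simp
qed

lemma nearest_pt_equidistant:
  assumes "1 \<le> n" and "\<And>j. j \<in> {1..n} \<Longrightarrow> dist x (s j) = d"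
  shows "nearest_pt s n x = s 1"
proof -
  have "(\<lambda>j. dist x (s j)) ` {1..n} = (\<lambda>_. d) ` {1..n}"
    by (intro image_cong refl assms(2))
  also have "\<dots> = {d}"
    using assms(1) by (simp add: image_constant_conv)
  finally have "Min ((\<lambda>j. dist x (s j)) ` {1..n}) = d"
    by simp
  moreover have "{k \<in> {1..n}. dist x (s k) = d} = {1..n}"
    using assms(2) by blast
  ultimately have "nearest_index s n x = Min {1..n}"
    unfolding nearest_index_def by simp
  also have "\<dots> = 1"
    using assms(1) by (intro Min_eqI) auto
  finally show ?thesis
    unfolding nearest_pt_def by simp
qed

text \<open>
  Take for \<open>\<delta>\<close> a lower bound for the distances between distinct points of \<open>s ` {1..n}\<close>.  If
  \<open>x\<close> and \<open>y\<close> are closer to each other than \<open>x\<close> is to this set, they see it at the same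
  distances; otherwise both have a nearest point closer than \<open>\<delta>\<close>, and these nearest points are
  closer than \<open>\<delta>\<close> to each other.
\<close>

lemma nearest_pt_locally_constant:
  fixes s :: "nat \<Rightarrow> 'a::metric_space"
  assumes ultrametric: "\<And>x y z :: 'a. dist x y \<le> max (dist x z) (dist z y)"
    and n: "1 \<le> n"
  obtains \<delta> where "\<delta> > 0" and "\<And>x y. dist x y < \<delta> \<Longrightarrow> nearest_pt s n x = nearest_pt s n y"
proof -
  let ?F = "s ` {1..n}"
  have "\<exists>\<delta>>0. \<forall>u\<in>?F. \<forall>v\<in>?F. dist u v < \<delta> \<longrightarrow> u = v"
  proof (rule exI, intro conjI ballI impI)
    \<comment> \<open>The extra element 1 keeps the minimum defined when all points coincide.\<close>
    let ?D = "insert 1 ((\<lambda>(u, v). dist u v) ` {w \<in> ?F \<times> ?F. fst w \<noteq> snd w})"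
    have fin: "finite ?D"
      by auto
    then show "Min ?D > 0"
      by (subst Min_gr_iff) auto
    fix u v assume "u \<in> ?F" "v \<in> ?F" and less: "dist u v < Min ?D"
    show "u = v"
    proof (rule ccontr)
      assume "u \<noteq> v"
      then have "dist u v \<in> ?D"
        using \<open>u \<in> ?F\<close> \<open>v \<in> ?F\<close> by (intro insertI2 image_eqI[of _ _ "(u, v)"]) auto
      then have "Min ?D \<le> dist u v"
        by (rule Min_le[OF fin])
      then show False
        using less by linarith
    qed
  qed
  then obtain \<delta> where \<delta>: "\<delta> > 0"
    and gap: "\<And>u v. u \<in> ?F \<Longrightarrow> v \<in> ?F \<Longrightarrow> dist u v < \<delta> \<Longrightarrow> u = v"
    by blast
  have "nearest_pt s n x = nearest_pt s n y" if xy: "dist x y < \<delta>" for x y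
  proof (cases "\<forall>j\<in>{1..n}. dist x y < dist x (s j)")
    case True
    then have "dist y (s j) = dist x (s j)" if "j \<in> {1..n}" for j
      using that by (intro ultrametric_isosceles[OF ultrametric]) blast
    then show ?thesis
      by (intro nearest_pt_cong) simp
  next
    case False
    then obtain j where j: "j \<in> {1..n}" and "dist x (s j) \<le> dist x y"
      by force
    then have xj: "dist x (s j) < \<delta>"
      using xy by linarith
    have yj: "dist y (s j) < \<delta>"
      using ultrametric[of y "s j" x] xj xy by (auto simp: dist_commute)
    have "dist x (nearest_pt s n x) < \<delta>" "dist y (nearest_pt s n y) < \<delta>"
      using dist_nearest_pt_le[OF j, where s = s, of x] dist_nearest_pt_le[OF j, where s = s, of y]
        xj yj by linarith+
    then have "dist (nearest_pt s n x) y < \<delta>" "dist y (nearest_pt s n y) < \<delta>"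
      using ultrametric[of "nearest_pt s n x" y x] xy by (auto simp: dist_commute)
    then have "dist (nearest_pt s n x) (nearest_pt s n y) < \<delta>"
      using ultrametric[of "nearest_pt s n x" "nearest_pt s n y" y] by auto
    then show ?thesis
      by (rule gap[OF nearest_pt_in_range[OF n] nearest_pt_in_range[OF n]])
  qed
  then show thesis
    using \<delta> that by blast
qed

text \<open>
  A point whose distance to \<open>s 1\<close> exceeds the radius of \<open>s ` {1..n}\<close> around \<open>s 1\<close> is
  equidistant from this whole set, and among its elements \<open>s 1\<close> has the least index.
\<close>

lemma nearest_pt_far_away:
  fixes s :: "nat \<Rightarrow> 'a::metric_space"
  assumes ultrametric: "\<And>x y z :: 'a. dist x y \<le> max (dist x z) (dist z y)"
    and n: "1 \<le> n"
  obtains R where "R \<ge> 0" and "\<And>x. x \<notin> cball (s 1) R \<Longrightarrow> nearest_pt s n x = s 1"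
proof -
  have "bounded (s ` {1..n})"
    by (simp add: finite_imp_bounded)
  then obtain R where R: "\<And>j. j \<in> {1..n} \<Longrightarrow> dist (s 1) (s j) \<le> R"
    unfolding bounded_any_center[where a = "s 1"] by blast
  have "nearest_pt s n x = s 1" if x: "x \<notin> cball (s 1) R" for x
  proof (rule nearest_pt_equidistant[OF n])
    fix j assume "j \<in> {1..n}"
    then have "dist (s 1) (s j) < dist (s 1) x"
      using R x by force
    then show "dist x (s j) = dist (s 1) x"
      using ultrametric_isosceles[OF ultrametric, of "s 1" "s j" x] by (simp add: dist_commute)
  qed
  moreover have "R \<ge> 0"
    using R[of 1] n by simp
  ultimately show thesis
    using that by blast
qed

lemma finite_segment_dense_in_compact:
  fixes s :: "nat \<Rightarrow> 'a::metric_space"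
  assumes "compact K" and dense: "closure (s ` {1..}) = UNIV" and "\<delta> > 0"
  obtains N where "N \<ge> 1" and "\<And>x. x \<in> K \<Longrightarrow> \<exists>j\<in>{1..N}. dist x (s j) < \<delta>"
proof -
  have cover: "K \<subseteq> (\<Union>j\<in>{1..}. ball (s j) \<delta>)"
  proof
    fix x
    have "x \<in> closure (s ` {1..})"
      using dense by simp
    then show "x \<in> (\<Union>j\<in>{1..}. ball (s j) \<delta>)"
      using \<open>\<delta> > 0\<close> unfolding closure_approachable by auto
  qed
  obtain J where J: "J \<subseteq> {1..}" "finite J" "K \<subseteq> (\<Union>j\<in>J. ball (s j) \<delta>)"
    by (rule compactE_image[OF \<open>compact K\<close> _ cover]) auto
  define N where "N = Max (insert 1 J)"
  have N: "k \<le> N" if "k \<in> insert 1 J" for k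
    unfolding N_def using J(2) that by (intro Max_ge) auto
  show thesis
  proof
    show "N \<ge> 1"
      using N by blast
    fix x assume "x \<in> K"
    then obtain j where "j \<in> J" "dist (s j) x < \<delta>"
      using J(3) by auto
    then show "\<exists>j\<in>{1..N}. dist x (s j) < \<delta>"
      using J(1) N by (auto simp: dist_commute intro!: bexI[of _ j])
  qed
qed

section \<open>Flatness at infinity without suprema\<close>

lemma outer_slopes_bounded:
  assumes "C-lipschitz_on UNIV f"
  shows "bdd_above (outer_slopes p f r)"
proof (rule bdd_aboveI)
  fix m assume "m \<in> outer_slopes p f r"
  then obtain x y where "x \<noteq> y" and m: "m = (f x - f y) / dist x y"
    unfolding outer_slopes_def by blast
  moreover have "f x - f y \<le> C * dist x y"
    using lipschitz_onD[OF assms, of x y] by (simp add: dist_real_def)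
  ultimately show "m \<le> C"
    by (simp add: divide_le_eq)
qed

text \<open>
  Exchanging the two points changes the sign of a slope, so the supremum of the outer slopes is
  also the supremum of their absolute values; in particular it is nonnegative, and convergence to
  \<open>0\<close> only asks for an upper bound.
\<close>

lemma flat_at_infinity_iff:
  assumes lip: "C-lipschitz_on UNIV f"
  shows "flat_at_infinity p f \<longleftrightarrow>
    (\<forall>\<epsilon>>0. \<exists>R. \<forall>x y. x \<notin> cball p R \<longrightarrow> \<bar>f x - f y\<bar> \<le> \<epsilon> * dist x y)"
    (is "_ \<longleftrightarrow> ?slopes")
proof
  let ?S = "\<lambda>r. if outer_slopes p f r = {} then 0 else Sup (outer_slopes p f r)"
  {
    assume "flat_at_infinity p f"
    then have lim: "(?S \<longlongrightarrow> 0) at_top"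
      unfolding flat_at_infinity_def .
    show ?slopes
    proof (intro allI impI)
      fix \<epsilon> :: real assume "\<epsilon> > 0"
      then have "\<forall>\<^sub>F r in at_top. ?S r < \<epsilon>"
        using order_tendstoD(2)[OF lim] by blast
      then obtain R where R: "?S R < \<epsilon>"
        unfolding eventually_at_top_linorder by blast
      have "\<bar>f x - f y\<bar> \<le> \<epsilon> * dist x y" if x: "x \<notin> cball p R" for x y
      proof (cases "x = y")
        case False
        have slope: "(f u - f v) / dist u v \<le> \<epsilon>" if "(u, v) \<in> {(x, y), (y, x)}" for u v
        proof -
          have mem: "(f u - f v) / dist u v \<in> outer_slopes p f R"
            unfolding outer_slopes_def using that x False by auto
          then have "(f u - f v) / dist u v \<le> Sup (outer_slopes p f R)"
            using outer_slopes_bounded[OF lip] by (rule cSup_upper)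
          also have "\<dots> < \<epsilon>"
            using R mem by (auto split: if_splits)
          finally show ?thesis
            by simp
        qed
        show ?thesis
          using slope[of x y] slope[of y x] False
          by (simp add: divide_le_eq dist_commute abs_le_iff)
      qed simp
      then show "\<exists>R. \<forall>x y. x \<notin> cball p R \<longrightarrow> \<bar>f x - f y\<bar> \<le> \<epsilon> * dist x y"
        by blast
    qed
  next
    assume slopes: ?slopes
    show "flat_at_infinity p f"
      unfolding flat_at_infinity_def
    proof (rule tendstoI)
      fix e :: real assume "e > 0"
      then obtain R
        where R: "\<And>x y. x \<notin> cball p R \<Longrightarrow> \<bar>f x - f y\<bar> \<le> e / 2 * dist x y"
        using slopes half_gt_zero by blast
      have "dist (?S r) 0 < e" if "r \<ge> R" for r
      proof (cases "outer_slopes p f r = {}")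
        case False
        then obtain x y where "x \<noteq> y" and out: "x \<notin> cball p r \<or> y \<notin> cball p r"
          unfolding outer_slopes_def by blast
        then have "(f x - f y) / dist x y \<in> outer_slopes p f r"
          and "(f y - f x) / dist y x \<in> outer_slopes p f r"
          unfolding outer_slopes_def by blast+
        then have "(f x - f y) / dist x y \<le> Sup (outer_slopes p f r)"
          and "(f y - f x) / dist y x \<le> Sup (outer_slopes p f r)"
          using outer_slopes_bounded[OF lip] by (auto intro: cSup_upper)
        moreover have "(f y - f x) / dist y x = - ((f x - f y) / dist x y)"
          by (simp add: dist_commute minus_divide_left)
        ultimately have "Sup (outer_slopes p f r) \<ge> 0"
          by linarith
        moreover have "Sup (outer_slopes p f r) \<le> e / 2"
        proof (rule cSup_least[OF False])
          fix m assume "m \<in> outer_slopes p f r"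
          then obtain u v where "u \<noteq> v" and m: "m = (f u - f v) / dist u v"
            and "u \<notin> cball p r \<or> v \<notin> cball p r"
            unfolding outer_slopes_def by blast
          then have "u \<notin> cball p R \<or> v \<notin> cball p R"
            using \<open>r \<ge> R\<close> by auto
          then have "\<bar>f u - f v\<bar> \<le> e / 2 * dist u v"
            using R[of u v] R[of v u] by (auto simp: dist_commute abs_minus_commute)
          then show "m \<le> e / 2"
            using \<open>u \<noteq> v\<close> abs_ge_self[of "f u - f v"] unfolding m
            by (simp add: pos_divide_le_eq)
        qed
        ultimately show ?thesis
          using False \<open>e > 0\<close> by (simp add: dist_real_def)
      qed (use \<open>e > 0\<close> in simp)
      then show "\<forall>\<^sub>F r in at_top. dist (?S r) 0 < e"
        unfolding eventually_at_top_linorder by blast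
    qed
  }
qed

section \<open>The two inclusions\<close>

lemma lip0u_subset_Y_space:
  fixes p :: "'a::metric_space"
  assumes ultrametric: "\<And>x y z :: 'a. dist x y \<le> max (dist x z) (dist z y)"
    and proper: "\<And>(x :: 'a) r. compact (cball x r)"
    and dense: "closure (s ` {1..}) = UNIV"
  shows "lip0u p \<subseteq> Y_space p s"
proof
  fix f assume f: "f \<in> lip0u p"
  then obtain C where lip: "C-lipschitz_on UNIV f"
    unfolding lip0u_def Lip0_def by blast
  have "\<exists>N\<ge>1. \<forall>x y. nearest_pt s N x = nearest_pt s N y \<longrightarrow> \<bar>f x - f y\<bar> \<le> \<epsilon> * dist x y"
    if "\<epsilon> > 0" for \<epsilon>
  proof -
    obtain R where R: "\<And>x y. x \<notin> cball p R \<Longrightarrow> \<bar>f x - f y\<bar> \<le> \<epsilon> * dist x y"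
      using f \<open>\<epsilon> > 0\<close> flat_at_infinity_iff[OF lip] unfolding lip0u_def by blast
    obtain \<delta> where "\<delta> > 0"
      and \<delta>: "\<And>x y. x \<noteq> y \<Longrightarrow> dist x y < \<delta> \<Longrightarrow> \<bar>f x - f y\<bar> < \<epsilon> * dist x y"
      using f \<open>\<epsilon> > 0\<close> unfolding lip0u_def uniformly_locally_flat_def by blast
    obtain N where "N \<ge> 1" and N: "\<And>x. x \<in> cball p R \<Longrightarrow> \<exists>j\<in>{1..N}. dist x (s j) < \<delta>"
      using finite_segment_dense_in_compact[OF proper dense \<open>\<delta> > 0\<close>] by blast
    have near: "dist x (nearest_pt s N x) < \<delta>" if "x \<in> cball p R" for x
      using N[OF that] dist_nearest_pt_le le_less_trans by blast
    have "\<bar>f x - f y\<bar> \<le> \<epsilon> * dist x y" if eq: "nearest_pt s N x = nearest_pt s N y" for x y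
    proof (cases "x \<in> cball p R \<and> y \<in> cball p R")
      case True
      then have "dist x y < \<delta>"
        using near[of x] near[of y] ultrametric[of x y "nearest_pt s N x"] eq
        by (auto simp: dist_commute)
      then show ?thesis
        using \<delta>[of x y] by (cases "x = y") auto
    next
      case False
      then show ?thesis
        using R[of x y] R[of y x] by (auto simp: dist_commute abs_minus_commute)
    qed
    then show ?thesis
      using \<open>N \<ge> 1\<close> by blast
  qed
  then show "f \<in> Y_space p s"
    using f unfolding lip0u_def Y_space_def by blast
qed

lemma Y_space_subset_lip0u:
  fixes p :: "'a::metric_space"
  assumes ultrametric: "\<And>x y z :: 'a. dist x y \<le> max (dist x z) (dist z y)"
    and s_1: "s 1 = p"
  shows "Y_space p s \<subseteq> lip0u p"
proof
  fix f assume f: "f \<in> Y_space p s"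
  then have f0: "f p = 0" and "\<exists>C. C-lipschitz_on UNIV f"
    unfolding Y_space_def Lip0_def by blast+
  then obtain C where lip: "C-lipschitz_on UNIV f"
    by blast
  have C: "C \<ge> 0"
    using lip by (rule lipschitz_on_nonneg)
  have Y: "\<exists>N\<ge>1. \<forall>x y. nearest_pt s N x = nearest_pt s N y \<longrightarrow> \<bar>f x - f y\<bar> \<le> \<epsilon> * dist x y"
    if "\<epsilon> > 0" for \<epsilon>
    using f that unfolding Y_space_def by blast
  have "uniformly_locally_flat f"
    unfolding uniformly_locally_flat_def
  proof (intro allI impI)
    fix \<epsilon> :: real assume "\<epsilon> > 0"
    then obtain N where "N \<ge> 1"
      and N: "\<And>x y. nearest_pt s N x = nearest_pt s N y \<Longrightarrow> \<bar>f x - f y\<bar> \<le> \<epsilon> / 2 * dist x y"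
      using Y[of "\<epsilon> / 2"] by auto
    obtain \<delta> where "\<delta> > 0"
      and \<delta>: "\<And>x y. dist x y < \<delta> \<Longrightarrow> nearest_pt s N x = nearest_pt s N y"
      using nearest_pt_locally_constant[OF ultrametric \<open>N \<ge> 1\<close>] by blast
    have "\<bar>f x - f y\<bar> < \<epsilon> * dist x y" if "x \<noteq> y" "dist x y < \<delta>" for x y
    proof -
      have "\<bar>f x - f y\<bar> \<le> \<epsilon> / 2 * dist x y"
        using N \<delta> that(2) by blast
      also have "\<dots> < \<epsilon> * dist x y"
        using \<open>\<epsilon> > 0\<close> \<open>x \<noteq> y\<close> by simp
      finally show ?thesis .
    qed
    then show "\<exists>\<delta>>0. \<forall>x y. x \<noteq> y \<and> dist x y < \<delta> \<longrightarrow> \<bar>f x - f y\<bar> < \<epsilon> * dist x y"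
      using \<open>\<delta> > 0\<close> by blast
  qed
  moreover have "flat_at_infinity p f"
    unfolding flat_at_infinity_iff[OF lip]
  proof (intro allI impI)
    fix \<epsilon> :: real assume "\<epsilon> > 0"
    then obtain N where "N \<ge> 1"
      and N: "\<And>x y. nearest_pt s N x = nearest_pt s N y \<Longrightarrow> \<bar>f x - f y\<bar> \<le> \<epsilon> / 2 * dist x y"
      using Y[of "\<epsilon> / 2"] by auto
    obtain R where "R \<ge> 0" and R: "\<And>x. x \<notin> cball p R \<Longrightarrow> nearest_pt s N x = p"
      using nearest_pt_far_away[where s = s, OF ultrametric \<open>N \<ge> 1\<close>] unfolding s_1 by blast
    have at_p: "nearest_pt s N p = p"
      using dist_nearest_pt_le[of 1 N p s] \<open>N \<ge> 1\<close> s_1 by simp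
    \<comment> \<open>The second bound on the radius makes \<open>C * R\<close>, the bound for \<open>f\<close> on \<open>cball p R\<close>, at most
      half of \<open>\<epsilon> * dist x p\<close>.\<close>
    define R' where "R' = max R (2 * C * R / \<epsilon>)"
    have "\<bar>f x - f y\<bar> \<le> \<epsilon> * dist x y" if x: "x \<notin> cball p R'" for x y
    proof -
      have x_far: "dist x p > R" "dist x p > 2 * C * R / \<epsilon>"
        using x unfolding R'_def by (auto simp: dist_commute)
      then have rx: "nearest_pt s N x = p"
        by (intro R) (simp add: dist_commute)
      show ?thesis
      proof (cases "y \<in> cball p R")
        case True
        have "dist x y = dist x p"
          using True x_far(1) ultrametric_isosceles[OF ultrametric, of p y x]
          by (simp add: dist_commute)
        moreover have "\<bar>f x\<bar> \<le> \<epsilon> / 2 * dist x p"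
          using N[of x p] rx at_p f0 by simp
        moreover have "\<bar>f y\<bar> \<le> \<epsilon> / 2 * dist x p"
        proof -
          have "\<bar>f y\<bar> \<le> C * dist y p"
            using lipschitz_onD[OF lip, of y p] f0 by (simp add: dist_real_def)
          also have "\<dots> \<le> C * R"
            using True C by (intro mult_left_mono) (auto simp: dist_commute)
          also have "\<dots> \<le> \<epsilon> / 2 * dist x p"
            using x_far(2) \<open>\<epsilon> > 0\<close> by (simp add: field_simps)
          finally show ?thesis .
        qed
        moreover have "\<bar>f x - f y\<bar> \<le> \<bar>f x\<bar> + \<bar>f y\<bar>"
          by (rule abs_triangle_ineq4)
        ultimately show ?thesis
          by simp
      next
        case False
        then have "\<bar>f x - f y\<bar> \<le> \<epsilon> / 2 * dist x y"
          using N rx R by simp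
        also have "\<dots> \<le> \<epsilon> * dist x y"
          using \<open>\<epsilon> > 0\<close> by (intro mult_right_mono) auto
        finally show ?thesis .
      qed
    qed
    then show "\<exists>R. \<forall>x y. x \<notin> cball p R \<longrightarrow> \<bar>f x - f y\<bar> \<le> \<epsilon> * dist x y"
      by blast
  qed
  ultimately show "f \<in> lip0u p"
    using f unfolding lip0u_def Y_space_def by blast
qed

theorem lemma4p10:
  fixes p :: "'a::metric_space" and s :: "nat \<Rightarrow> 'a"
  assumes ultrametric: "\<And>x y z :: 'a. dist x y \<le> max (dist x z) (dist z y)"
    and proper: "\<And>(x :: 'a) r. compact (cball x r)"
    and s_inj: "inj_on s {1..}"
    and s_dense: "closure (s ` {1..}) = UNIV"
    and s_1: "s 1 = p"
  shows "lip0u p = Y_space p s"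
proof (rule equalityI)
  show "lip0u p \<subseteq> Y_space p s"
    by (rule lip0u_subset_Y_space[of s p, OF ultrametric proper s_dense])
  show "Y_space p s \<subseteq> lip0u p"
    by (rule Y_space_subset_lip0u[of s p, OF ultrametric s_1])
qed

end
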